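(* Let $p=2$. Let $A,B$ be $\delta$-$\widetilde{\mathrm C}$artier rings and let $f:A\to B$ be a map of $\delta$-rings such that $f(\tilde V(A))\subset\tilde V(B)$, where $\tilde V(A)$ and $\tilde V(B)$ denote the image ideals of $\tilde V$. Then $f$ is a map of $\delta$-$\widetilde{\mathrm C}$artier rings (i.e. $f$ commutes with $\tilde V$). Equivalently, the functor $A\mapsto(A,\tilde V(A))$ from $\delta$-$\widetilde{\mathrm C}$artier rings to the category of pairs $(A,I)$ with $A$ a $\delta$-ring and $I\subset A$ an ideal is fully faithful, where morphisms of pairs are $\delta$-ring maps preserving the distinguished ideals (carrying the ideal of the source into that of the target).
   Context: All rings are commutative with unit; here $p=2$. A $\delta$-ring is a ring $A$ with a map $\delta:A\to A$ such that $\delta(0)=\delta(1)=0$, $\delta(x+y)=\delta(x)+\delta(y)-xy$ and $\delta(xy)=x^2\delta(y)+y^2\delta(x)+2\delta(x)\delta(y)$; its Frobenius is $F(a)=a^2+2\delta(a)$. A $\delta$-$\widetilde{\mathrm C}$artier ring is a $\delta$-ring $A$ with an additive map $\tilde V:A\to A$ such that, with $\tilde 2:=F(\tilde V(1))\in A$: (1) $\tilde 2^2=4$ and $\delta(\tilde 2)=-1$; (2) $F(\tilde V(a))=\tilde 2a$ for all $a$; (3) $a\tilde V(b)=\tilde V(F(a)b)$ for all $a,b$; (4) $\delta(\tilde V(a))=-a+\tilde V(\tilde 2\delta(a))$ for all $a$. Morphisms are $\delta$-ring maps commuting with $\tilde V$. *)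

theory Defs
  imports "HOL-Algebra.RingHom"
begin

section \<open>Delta-rings for the prime 2\<close>

text \<open>The values of the operations outside the carrier are irrelevant.
  As in HOL-Algebra, the zero ring is allowed.\<close>

record 'a delta_ring = "'a ring" +
  delta :: "'a \<Rightarrow> 'a" (\<open>\<delta>\<index>\<close>)

locale delta_ring = cring R for R (structure) +
  assumes delta_closed: "a \<in> carrier R \<Longrightarrow> \<delta> a \<in> carrier R"
    and delta_zero: "\<delta> \<zero> = \<zero>"
    and delta_one: "\<delta> \<one> = \<zero>"
    and delta_add: "\<lbrakk>a \<in> carrier R; b \<in> carrier R\<rbrakk> \<Longrightarrow>
          \<delta> (a \<oplus> b) = (\<delta> a \<oplus> \<delta> b) \<ominus> a \<otimes> b"
    and delta_mult: "\<lbrakk>a \<in> carrier R; b \<in> carrier R\<rbrakk> \<Longrightarrow>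
          \<delta> (a \<otimes> b) =
            a [^] (2::nat) \<otimes> \<delta> b \<oplus> b [^] (2::nat) \<otimes> \<delta> a \<oplus> [(2::nat)] \<cdot> (\<delta> a \<otimes> \<delta> b)"

definition frobenius :: "('a, 'm) delta_ring_scheme \<Rightarrow> 'a \<Rightarrow> 'a" (\<open>\<F>\<index>\<close>)
  where "\<F>\<^bsub>R\<^esub> a = a [^]\<^bsub>R\<^esub> (2::nat) \<oplus>\<^bsub>R\<^esub> [(2::nat)] \<cdot>\<^bsub>R\<^esub> (\<delta>\<^bsub>R\<^esub> a)"

definition delta_ring_hom ::
    "('a, 'm) delta_ring_scheme \<Rightarrow> ('b, 'n) delta_ring_scheme \<Rightarrow> ('a \<Rightarrow> 'b) set"
  where "delta_ring_hom A B =
    {f \<in> ring_hom A B. \<forall>a \<in> carrier A. f (\<delta>\<^bsub>A\<^esub> a) = \<delta>\<^bsub>B\<^esub> (f a)}"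


section \<open>Delta-C-tilde-artier rings\<close>

record 'a delta_cartier_ring = "'a delta_ring" +
  versch :: "'a \<Rightarrow> 'a" (\<open>\<V>\<index>\<close>)

definition two_tilde :: "('a, 'm) delta_cartier_ring_scheme \<Rightarrow> 'a" (\<open>\<two>\<index>\<close>)
  where "\<two>\<^bsub>R\<^esub> = \<F>\<^bsub>R\<^esub> (\<V>\<^bsub>R\<^esub> \<one>\<^bsub>R\<^esub>)"

locale delta_cartier_ring = delta_ring R for R (structure) +
  assumes versch_closed: "a \<in> carrier R \<Longrightarrow> \<V> a \<in> carrier R"
    and versch_add: "\<lbrakk>a \<in> carrier R; b \<in> carrier R\<rbrakk> \<Longrightarrow> \<V> (a \<oplus> b) = \<V> a \<oplus> \<V> b"
    and two_tilde_square: "\<two> [^] (2::nat) = [(4::nat)] \<cdot> \<one>"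
    and delta_two_tilde: "\<delta> \<two> = \<ominus> \<one>"
    and frobenius_versch: "a \<in> carrier R \<Longrightarrow> \<F> (\<V> a) = \<two> \<otimes> a"
    and projection: "\<lbrakk>a \<in> carrier R; b \<in> carrier R\<rbrakk> \<Longrightarrow> a \<otimes> \<V> b = \<V> (\<F> a \<otimes> b)"
    and delta_versch: "a \<in> carrier R \<Longrightarrow> \<delta> (\<V> a) = \<ominus> a \<oplus> \<V> (\<two> \<otimes> \<delta> a)"

definition delta_cartier_ring_hom ::
    "('a, 'm) delta_cartier_ring_scheme \<Rightarrow> ('b, 'n) delta_cartier_ring_scheme \<Rightarrow> ('a \<Rightarrow> 'b) set"
  where "delta_cartier_ring_hom A B =
    {f \<in> delta_ring_hom A B. \<forall>a \<in> carrier A. f (\<V>\<^bsub>A\<^esub> a) = \<V>\<^bsub>B\<^esub> (f a)}"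

definition versch_ideal :: "('a, 'm) delta_cartier_ring_scheme \<Rightarrow> 'a set"
  where "versch_ideal A = versch A ` carrier A"


section \<open>Categories and functors\<close>

text \<open>Morphism sets need not be disjoint, so composition takes its three objects as arguments:
  \<open>cat_comp C X Y Z g f\<close> is the composite of \<open>f\<close> from \<open>X\<close> to \<open>Y\<close> with \<open>g\<close> from \<open>Y\<close> to \<open>Z\<close>.\<close>

record ('o, 'm) cat =
  cat_obj :: "'o set"
  cat_hom :: "'o \<Rightarrow> 'o \<Rightarrow> 'm set"
  cat_id :: "'o \<Rightarrow> 'm"
  cat_comp :: "'o \<Rightarrow> 'o \<Rightarrow> 'o \<Rightarrow> 'm \<Rightarrow> 'm \<Rightarrow> 'm"

locale category =
  fixes C :: "('o, 'm) cat"
  assumes id_in_hom: "X \<in> cat_obj C \<Longrightarrow> cat_id C X \<in> cat_hom C X X"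
    and comp_in_hom: "\<lbrakk>X \<in> cat_obj C; Y \<in> cat_obj C; Z \<in> cat_obj C;
          f \<in> cat_hom C X Y; g \<in> cat_hom C Y Z\<rbrakk> \<Longrightarrow> cat_comp C X Y Z g f \<in> cat_hom C X Z"
    and comp_id_left: "\<lbrakk>X \<in> cat_obj C; Y \<in> cat_obj C; f \<in> cat_hom C X Y\<rbrakk> \<Longrightarrow>
          cat_comp C X Y Y (cat_id C Y) f = f"
    and comp_id_right: "\<lbrakk>X \<in> cat_obj C; Y \<in> cat_obj C; f \<in> cat_hom C X Y\<rbrakk> \<Longrightarrow>
          cat_comp C X X Y f (cat_id C X) = f"
    and comp_assoc: "\<lbrakk>W \<in> cat_obj C; X \<in> cat_obj C; Y \<in> cat_obj C; Z \<in> cat_obj C;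
          f \<in> cat_hom C W X; g \<in> cat_hom C X Y; h \<in> cat_hom C Y Z\<rbrakk> \<Longrightarrow>
          cat_comp C W Y Z h (cat_comp C W X Y g f) = cat_comp C W X Z (cat_comp C X Y Z h g) f"

locale cat_functor = source: category C + target: category D
  for C :: "('o1, 'm1) cat" and D :: "('o2, 'm2) cat" +
  fixes Fo :: "'o1 \<Rightarrow> 'o2" and Fm :: "'o1 \<Rightarrow> 'o1 \<Rightarrow> 'm1 \<Rightarrow> 'm2"
  assumes preserves_obj: "X \<in> cat_obj C \<Longrightarrow> Fo X \<in> cat_obj D"
    and preserves_hom: "\<lbrakk>X \<in> cat_obj C; Y \<in> cat_obj C; f \<in> cat_hom C X Y\<rbrakk> \<Longrightarrow>
          Fm X Y f \<in> cat_hom D (Fo X) (Fo Y)"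
    and preserves_id: "X \<in> cat_obj C \<Longrightarrow> Fm X X (cat_id C X) = cat_id D (Fo X)"
    and preserves_comp: "\<lbrakk>X \<in> cat_obj C; Y \<in> cat_obj C; Z \<in> cat_obj C;
          f \<in> cat_hom C X Y; g \<in> cat_hom C Y Z\<rbrakk> \<Longrightarrow>
          Fm X Z (cat_comp C X Y Z g f) = cat_comp D (Fo X) (Fo Y) (Fo Z) (Fm Y Z g) (Fm X Y f)"

locale fully_faithful_functor = cat_functor +
  assumes bij_on_homs: "\<lbrakk>X \<in> cat_obj C; Y \<in> cat_obj C\<rbrakk> \<Longrightarrow>
    bij_betw (Fm X Y) (cat_hom C X Y) (cat_hom D (Fo X) (Fo Y))"


section \<open>The two categories and the functor between them\<close>

text \<open>Morphisms are maps between carriers; they are represented by extensional functions, so that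
  equality of morphisms is equality on the carrier of the source.
  All objects of one category have their carriers in a common type.\<close>

definition delta_cartier_ring_cat :: "('a delta_cartier_ring, 'a \<Rightarrow> 'a) cat"
  where "delta_cartier_ring_cat =
    \<lparr>cat_obj = {A. delta_cartier_ring A},
     cat_hom = (\<lambda>A B. delta_cartier_ring_hom A B \<inter> extensional (carrier A)),
     cat_id = (\<lambda>A. \<lambda>a \<in> carrier A. a),
     cat_comp = (\<lambda>A B C g f. compose (carrier A) g f)\<rparr>"

definition delta_pair_cat :: "('a delta_ring \<times> 'a set, 'a \<Rightarrow> 'a) cat"
  where "delta_pair_cat =
    \<lparr>cat_obj = {(A, I). delta_ring A \<and> ideal I A},
     cat_hom = (\<lambda>(A, I) (B, J).
       {f \<in> delta_ring_hom A B \<inter> extensional (carrier A). f ` I \<subseteq> J}),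
     cat_id = (\<lambda>(A, I). \<lambda>a \<in> carrier A. a),
     cat_comp = (\<lambda>(A, I) (B, J) (C, K) g f. compose (carrier A) g f)\<rparr>"

text \<open>\<open>delta_ring.truncate\<close> forgets the field \<open>versch\<close>.\<close>

definition underlying_pair :: "'a delta_cartier_ring \<Rightarrow> 'a delta_ring \<times> 'a set"
  where "underlying_pair A = (delta_ring.truncate A, versch_ideal A)"

end

theory Submission
  imports Defs "HOL-Decision_Procs.Algebra_Aux"
begin

text \<open>Write \<open>\<V>\<close> for the Verschiebung, \<open>\<F>\<close> for the Frobenius and \<open>\<two>\<close> for \<open>\<F> (\<V> \<one>)\<close>.
  Ideal-preservation says only that \<open>f (\<V> a) = \<V> c\<close> for some \<open>c\<close>, and the task is to show
  \<open>c = f a\<close>. If \<open>\<two>\<close> were a non-zero-divisor in the target, then \<open>\<F> (\<V> c) = \<two> \<otimes> c\<close> would decide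
  this at once. In general \<open>\<two>\<close> may kill elements, and the axiom
  \<open>\<delta> (\<V> c) = \<ominus> c \<oplus> \<V> (\<two> \<otimes> \<delta> c)\<close>, which recovers \<open>c\<close> up to an element of the image of \<open>\<V>\<close>,
  has to supply the missing information. The interplay of the two axioms rests on
  \<open>\<delta> (\<two> \<otimes> x) = 2 \<delta> x \<ominus> x\<^sup>2\<close> (lemma \<open>delta_two_tilde_mult\<close>), which turns every relation \<open>\<two> \<otimes> x = \<zero>\<close>
  into \<open>x\<^sup>2 = 2 \<delta> x\<close>, and on \<open>\<two> \<otimes> \<V> x = \<V> (2 x)\<close>, which turns multiplication by \<open>\<two>\<close> into
  multiplication by \<open>2\<close> under \<open>\<V>\<close>. Since \<open>\<two>\<^sup>2 = 4\<close>, everything in question is killed by a small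
  power of \<open>2\<close>, and alternating these rules lowers the power until nothing is left.

  Three statements inside one ring are proved in this way.
  The map \<open>\<V>\<close> is injective (\<open>versch_eq_zeroD\<close>).
  The element \<open>\<V> \<one>\<close> is characterised, among the elements \<open>x\<close> of the ideal, by
  \<open>\<delta> x = \<ominus> \<one>\<close>, \<open>\<delta> (\<F> x) = \<ominus> \<one>\<close> and \<open>(\<F> x)\<^sup>2 = 4\<close> (\<open>eq_one_if_versch_like_versch_one\<close>);
  these conditions use only the delta-ring structure and the ideal, so \<open>f (\<V> \<one>) = \<V> \<one>\<close> and hence \<open>f \<two> = \<two>\<close>.
  The element \<open>\<V> u\<close> is the only one of the ideal with its Frobenius and its \<open>\<delta>\<close>
  (\<open>eq_if_frobenius_delta_versch\<close>).
  For the last criterion, \<open>\<delta> (f (\<V> a))\<close> involves \<open>f (\<V> (\<two> \<otimes> \<delta> a))\<close>, which is known because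
  \<open>\<V> (\<two> \<otimes> b) = \<V> \<one> \<otimes> \<V> b\<close> and \<open>f (\<V> \<one>) = \<V> \<one>\<close>.

  Full faithfulness is then a reformulation: a map of delta-rings preserves the ideals if and only
  if it commutes with \<open>\<V>\<close>, so the functor is the identity between equal sets of morphisms.\<close>

section \<open>Computing in a delta-ring\<close>

lemma (in cring) add_pow_two: "x \<in> carrier R \<Longrightarrow> [(2::nat)] \<cdot> x = \<guillemotleft>2\<guillemotright> \<otimes> x"
  by (simp add: numeral_2_eq_2 of_int_2 l_distr)

lemma (in cring) add_pow_four_one: "[(4::nat)] \<cdot> \<one> = \<guillemotleft>4\<guillemotright>"
  by (simp add: eval_nat_numeral of_integer_def a_ac)

text \<open>Written as sums of \<open>\<one>\<close>, numerals are within reach of the method \<open>algebra\<close>.\<close>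

lemma (in cring) of_int_numerals:
  "\<guillemotleft>2\<guillemotright> = \<one> \<oplus> \<one>" "\<guillemotleft>4\<guillemotright> = \<one> \<oplus> \<one> \<oplus> (\<one> \<oplus> \<one>)"
  "\<guillemotleft>8\<guillemotright> = \<one> \<oplus> \<one> \<oplus> (\<one> \<oplus> \<one>) \<oplus> (\<one> \<oplus> \<one> \<oplus> (\<one> \<oplus> \<one>))"
proof -
  show "\<guillemotleft>2\<guillemotright> = \<one> \<oplus> \<one>" by (rule of_int_2)
  have "\<guillemotleft>2 + 2\<guillemotright> = \<one> \<oplus> \<one> \<oplus> (\<one> \<oplus> \<one>)" by (simp only: of_int_add of_int_2)
  then show 4: "\<guillemotleft>4\<guillemotright> = \<one> \<oplus> \<one> \<oplus> (\<one> \<oplus> \<one>)" by simp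
  have "\<guillemotleft>4 + 4\<guillemotright> = \<one> \<oplus> \<one> \<oplus> (\<one> \<oplus> \<one>) \<oplus> (\<one> \<oplus> \<one> \<oplus> (\<one> \<oplus> \<one>))"
    by (simp only: of_int_add 4)
  then show "\<guillemotleft>8\<guillemotright> = \<one> \<oplus> \<one> \<oplus> (\<one> \<oplus> \<one>) \<oplus> (\<one> \<oplus> \<one> \<oplus> (\<one> \<oplus> \<one>))" by simp
qed

context delta_ring
begin

lemma frobenius_eq: "a \<in> carrier R \<Longrightarrow> \<F> a = a \<otimes> a \<oplus> \<guillemotleft>2\<guillemotright> \<otimes> \<delta> a"
  by (simp add: frobenius_def add_pow_two power2_eq_square delta_closed)

lemma frobenius_closed: "a \<in> carrier R \<Longrightarrow> \<F> a \<in> carrier R"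
  by (simp add: frobenius_eq delta_closed)

lemma delta_double:
  assumes "a \<in> carrier R"
  shows "\<delta> (\<guillemotleft>2\<guillemotright> \<otimes> a) = \<guillemotleft>2\<guillemotright> \<otimes> \<delta> a \<ominus> a \<otimes> a"
  using assms by (simp add: of_int_2 l_distr delta_add delta_closed)

text \<open>Applying \<open>\<delta>\<close> to \<open>2 a = \<zero>\<close> gives \<open>2 \<delta> a = a\<^sup>2\<close>, so \<open>\<F> a = 2 a\<^sup>2\<close>, a multiple of \<open>2 a\<close>.\<close>

lemma frobenius_two_torsion:
  assumes a: "a \<in> carrier R" and "\<guillemotleft>2\<guillemotright> \<otimes> a = \<zero>"
  shows "\<F> a = \<zero>"
proof -
  obtain d where d: "d = \<delta> a" "d \<in> carrier R" using a delta_closed by blast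
  have "a \<otimes> a \<oplus> \<guillemotleft>2\<guillemotright> \<otimes> d = (\<guillemotleft>2\<guillemotright> \<otimes> d \<ominus> a \<otimes> a) \<oplus> \<guillemotleft>2\<guillemotright> \<otimes> a \<otimes> a"
    unfolding of_int_numerals using a d(2) by algebra
  moreover have "\<guillemotleft>2\<guillemotright> \<otimes> d \<ominus> a \<otimes> a = \<zero>"
    using delta_double[OF a] assms(2) by (simp add: d(1) delta_zero)
  ultimately show ?thesis
    using a d assms(2) by (simp add: frobenius_eq)
qed

end

section \<open>The Verschiebung\<close>

context delta_cartier_ring
begin

lemma two_tilde_closed [simp]: "\<two> \<in> carrier R"
  by (simp add: two_tilde_def frobenius_closed versch_closed)

lemma two_tilde_mult: "\<two> \<otimes> \<two> = \<guillemotleft>4\<guillemotright>"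
  using two_tilde_square by (simp add: power2_eq_square add_pow_four_one)

lemma frobenius_two_tilde: "\<F> \<two> = \<guillemotleft>2\<guillemotright>"
proof -
  have "\<guillemotleft>4\<guillemotright> \<oplus> \<guillemotleft>2\<guillemotright> \<otimes> (\<ominus> \<one>) = \<guillemotleft>2\<guillemotright>"
    unfolding of_int_numerals by algebra
  then show ?thesis by (simp add: frobenius_eq two_tilde_mult delta_two_tilde)
qed

text \<open>The product rule reads \<open>4 \<delta> a \<ominus> a\<^sup>2 \<ominus> 2 \<delta> a\<close> here; the outcome is the same as for \<open>\<delta> (2 a)\<close>.\<close>

lemma delta_two_tilde_mult:
  assumes a: "a \<in> carrier R"
  shows "\<delta> (\<two> \<otimes> a) = \<guillemotleft>2\<guillemotright> \<otimes> \<delta> a \<ominus> a \<otimes> a"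
proof -
  obtain d where d: "d = \<delta> a" "d \<in> carrier R" using a delta_closed by blast
  have "\<guillemotleft>4\<guillemotright> \<otimes> d \<oplus> a \<otimes> a \<otimes> (\<ominus> \<one>) \<oplus> \<guillemotleft>2\<guillemotright> \<otimes> ((\<ominus> \<one>) \<otimes> d) = \<guillemotleft>2\<guillemotright> \<otimes> d \<ominus> a \<otimes> a"
    unfolding of_int_numerals using a d(2) by algebra
  then show ?thesis
    using a d by (simp add: delta_mult power2_eq_square two_tilde_mult delta_two_tilde add_pow_two)
qed

lemma versch_zero [simp]: "\<V> \<zero> = \<zero>"
proof -
  have "\<V> \<zero> \<oplus> \<V> \<zero> = \<V> \<zero>" using versch_add[of \<zero> \<zero>] by simp
  then show ?thesis using versch_closed[of \<zero>] by (metis add.l_cancel_one zero_closed)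
qed

lemma versch_minus: "a \<in> carrier R \<Longrightarrow> \<V> (\<ominus> a) = \<ominus> \<V> a"
  using versch_add[of "\<ominus> a" a] by (simp add: minus_equality versch_closed l_neg)

lemma versch_diff: "\<lbrakk>a \<in> carrier R; b \<in> carrier R\<rbrakk> \<Longrightarrow> \<V> (a \<ominus> b) = \<V> a \<ominus> \<V> b"
  by (simp add: minus_eq versch_add versch_minus)

lemma versch_double: "a \<in> carrier R \<Longrightarrow> \<V> (\<guillemotleft>2\<guillemotright> \<otimes> a) = \<guillemotleft>2\<guillemotright> \<otimes> \<V> a"
  by (simp add: of_int_2 l_distr versch_add versch_closed)

lemma two_tilde_versch: "a \<in> carrier R \<Longrightarrow> \<two> \<otimes> \<V> a = \<V> (\<guillemotleft>2\<guillemotright> \<otimes> a)"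
  by (simp add: projection frobenius_two_tilde)

lemma versch_mult: "\<lbrakk>a \<in> carrier R; b \<in> carrier R\<rbrakk> \<Longrightarrow> \<V> a \<otimes> \<V> b = \<V> (\<two> \<otimes> a \<otimes> b)"
  by (simp add: projection frobenius_versch versch_closed)

lemma versch_ideal_is_ideal: "ideal (versch_ideal R) R"
proof (rule idealI)
  show "ring R" ..
  show "subgroup (versch_ideal R) (add_monoid R)"
  proof (rule add.subgroupI)
    show "versch_ideal R \<subseteq> carrier R" by (auto simp: versch_ideal_def versch_closed)
    show "versch_ideal R \<noteq> {}" by (auto simp: versch_ideal_def)
    show "\<ominus> x \<in> versch_ideal R" if "x \<in> versch_ideal R" for x
      using that by (force simp: versch_ideal_def simp flip: versch_minus)
    show "x \<oplus> y \<in> versch_ideal R" if "x \<in> versch_ideal R" "y \<in> versch_ideal R" for x y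
      using that by (force simp: versch_ideal_def simp flip: versch_add)
  qed
  show "x \<otimes> a \<in> versch_ideal R" if "a \<in> versch_ideal R" "x \<in> carrier R" for a x
    using that by (force simp: versch_ideal_def projection frobenius_closed)
  then show "a \<otimes> x \<in> versch_ideal R" if "a \<in> versch_ideal R" "x \<in> carrier R" for a x
    using that m_comm[of a x] by (force simp: versch_ideal_def versch_closed)
qed

text \<open>Put \<open>d = \<delta> a\<close>. From \<open>\<V> a = \<zero>\<close> the axioms give \<open>\<two> \<otimes> a = \<zero>\<close> and \<open>a = \<V> (\<two> \<otimes> d)\<close>, hence
  \<open>2 d = a\<^sup>2\<close> and \<open>2 \<two> \<otimes> d = \<zero>\<close>. The projection formula for \<open>a \<otimes> a\<close> now shows
  \<open>a\<^sup>2 = \<zero>\<close>, so \<open>2 d = \<zero>\<close> and \<open>\<delta> (\<two> \<otimes> d) = \<delta> (2 d) = \<zero>\<close>. Computing \<open>\<delta> a\<close> from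
  \<open>a = \<V> (\<two> \<otimes> d)\<close> then gives \<open>d = \<ominus> \<two> \<otimes> d\<close>, and multiplying by \<open>\<two>\<close> shows \<open>\<two> \<otimes> d = \<zero>\<close>.\<close>

lemma versch_eq_zeroD:
  assumes a: "a \<in> carrier R" and Va: "\<V> a = \<zero>"
  shows "a = \<zero>"
proof -
  obtain t where t: "t = \<two>" "t \<in> carrier R" by simp
  obtain d where d: "d = \<delta> a" "d \<in> carrier R" using a delta_closed by blast
  obtain e where e: "e = \<delta> d" "e \<in> carrier R" using d delta_closed by blast
  note R = a t(2) d(2) e(2)
  have tt: "t \<otimes> t = \<guillemotleft>4\<guillemotright>" by (simp add: t(1) two_tilde_mult)
  have "\<ominus> a \<oplus> \<V> (t \<otimes> d) = \<zero>"
    using delta_versch[OF a] by (simp add: Va delta_zero t d)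
  then have a_eq: "a = \<V> (t \<otimes> d)"
    using R by (metis add.inv_closed m_closed minus_equality minus_minus versch_closed a_comm)
  have ta: "t \<otimes> a = \<zero>"
    using frobenius_versch[OF a] Va by (simp add: t frobenius_eq delta_zero)
  have aa: "\<guillemotleft>2\<guillemotright> \<otimes> d = a \<otimes> a"
    using delta_two_tilde_mult[OF a, symmetric] R
    by (simp add: ta delta_zero eq_diff0 flip: t(1) d(1))
  have "t \<otimes> (\<guillemotleft>2\<guillemotright> \<otimes> d) = t \<otimes> a \<otimes> a" using R by (simp add: aa m_assoc)
  then have td2: "t \<otimes> (\<guillemotleft>2\<guillemotright> \<otimes> d) = \<zero>" using R by (simp add: ta)
  \<comment> \<open>Since \<open>a\<^sup>2 = 2 d\<close>, the Frobenius of \<open>a\<close> is \<open>4 d\<close>; one factor \<open>2\<close> is moved next to \<open>\<two> \<otimes> d\<close>.\<close>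
  have Fa: "\<F> a \<otimes> (t \<otimes> d) = \<guillemotleft>2\<guillemotright> \<otimes> d \<otimes> (t \<otimes> (\<guillemotleft>2\<guillemotright> \<otimes> d))"
  proof -
    have "(\<guillemotleft>2\<guillemotright> \<otimes> d \<oplus> \<guillemotleft>2\<guillemotright> \<otimes> d) \<otimes> (t \<otimes> d) = \<guillemotleft>2\<guillemotright> \<otimes> d \<otimes> (t \<otimes> (\<guillemotleft>2\<guillemotright> \<otimes> d))"
      unfolding of_int_numerals using R by algebra
    then show ?thesis using a by (simp add: frobenius_eq flip: aa d(1))
  qed
  have "a \<otimes> a = \<V> (\<F> a \<otimes> (t \<otimes> d))"
    using projection[OF a, of "t \<otimes> d"] R by (simp flip: a_eq)
  then have "a \<otimes> a = \<zero>" using R by (simp add: Fa td2)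
  then have d2: "\<guillemotleft>2\<guillemotright> \<otimes> d = \<zero>" by (simp add: aa)
  have "\<guillemotleft>2\<guillemotright> \<otimes> e \<ominus> d \<otimes> d = \<zero>"
    using delta_double[OF d(2)] by (simp add: d2 e delta_zero)
  then have delta_td: "\<delta> (t \<otimes> d) = \<zero>"
    using delta_two_tilde_mult[OF d(2)] by (simp add: t e)
  then have d_eq: "d = \<ominus> (t \<otimes> d)"
    using delta_versch[of "t \<otimes> d"] R delta_td by (simp flip: a_eq d(1) t(1))
  have "\<guillemotleft>2\<guillemotright> \<otimes> (\<guillemotleft>2\<guillemotright> \<otimes> d) = t \<otimes> t \<otimes> d" unfolding tt
    unfolding of_int_numerals using R by algebra
  then have "t \<otimes> (t \<otimes> d) = \<zero>" using R by (simp add: d2 m_assoc)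
  then have "t \<otimes> d = \<zero>" using arg_cong[OF d_eq, of "\<lambda>x. t \<otimes> x"] R by (simp add: r_minus)
  then show ?thesis using a_eq by simp
qed

text \<open>The hypotheses say that \<open>x = \<V> e\<close> satisfies \<open>\<delta> x = \<ominus> \<one>\<close>, \<open>\<delta> (\<F> x) = \<ominus> \<one>\<close> and
  \<open>(\<F> x)\<^sup>2 = 4\<close>, as \<open>\<V> \<one>\<close> does. With \<open>d = \<delta> e\<close> and \<open>y = \<two> \<otimes> d\<close> they become
  \<open>e = \<one> \<oplus> \<V> y\<close>, \<open>e\<^sup>2 = \<one> \<oplus> 2 d\<close> and \<open>8 d = \<zero>\<close>.
  Comparing the two expressions for \<open>e\<^sup>2\<close> gives \<open>2 d = \<V> w\<close> with \<open>w = 2 y \<oplus> \<two> \<otimes> y\<^sup>2\<close>.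
  Multiplication by \<open>\<two>\<close> turns this into \<open>2 y = \<V> (4 y)\<close>, and then
  \<open>4 y = \<V> (8 y) = \<zero>\<close>, \<open>2 y = \<zero>\<close> and \<open>2 d = \<zero>\<close> follow in turn. So \<open>\<delta> y = \<zero>\<close>, and computing
  \<open>d = \<delta> (\<one> \<oplus> \<V> y) = \<ominus> y \<ominus> \<V> y\<close> and multiplying by \<open>\<two>\<close> gives \<open>y = \<zero>\<close>.\<close>

lemma eq_one_if_versch_like_versch_one:
  assumes e: "e \<in> carrier R"
    and delta_Ve: "\<delta> (\<V> e) = \<ominus> \<one>"
    and delta_FVe: "\<delta> (\<two> \<otimes> e) = \<ominus> \<one>"
    and FVe_square: "(\<two> \<otimes> e) \<otimes> (\<two> \<otimes> e) = \<guillemotleft>4\<guillemotright>"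
  shows "e = \<one>"
proof -
  obtain t where t: "t = \<two>" "t \<in> carrier R" by simp
  obtain d where d: "d = \<delta> e" "d \<in> carrier R" using e delta_closed by blast
  obtain z where z: "z = \<delta> d" "z \<in> carrier R" using d delta_closed by blast
  obtain y where y: "y = t \<otimes> d" "y \<in> carrier R" using t d by simp
  obtain v where v: "v = \<V> y" "v \<in> carrier R" using y versch_closed by simp
  note R = e t(2) d(2) z(2) y(2) v(2)
  have tt: "t \<otimes> t = \<guillemotleft>4\<guillemotright>" by (simp add: t(1) two_tilde_mult)
  have "\<ominus> e \<oplus> v = \<ominus> \<one>" using delta_versch[OF e] delta_Ve by (simp add: t d v y)
  moreover have "e = v \<ominus> (\<ominus> e \<oplus> v)" unfolding of_int_numerals using R by algebra
  ultimately have e_eq: "e = \<one> \<oplus> v" using R by (simp add: minus_eq a_comm)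
  have "\<guillemotleft>2\<guillemotright> \<otimes> d \<ominus> e \<otimes> e = \<ominus> \<one>" using delta_two_tilde_mult[OF e] delta_FVe by (simp add: d)
  moreover have "e \<otimes> e = \<guillemotleft>2\<guillemotright> \<otimes> d \<ominus> (\<guillemotleft>2\<guillemotright> \<otimes> d \<ominus> e \<otimes> e)"
    unfolding of_int_numerals using R by algebra
  ultimately have ee: "e \<otimes> e = \<guillemotleft>2\<guillemotright> \<otimes> d \<ominus> (\<ominus> \<one>)" by simp
  have d8: "\<guillemotleft>8\<guillemotright> \<otimes> d = \<zero>"
  proof -
    have "\<guillemotleft>8\<guillemotright> \<otimes> d = \<guillemotleft>4\<guillemotright> \<otimes> (\<guillemotleft>2\<guillemotright> \<otimes> d \<ominus> (\<ominus> \<one>)) \<ominus> \<guillemotleft>4\<guillemotright>"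
      unfolding of_int_numerals using R by algebra
    also have "\<dots> = (t \<otimes> t) \<otimes> (e \<otimes> e) \<ominus> \<guillemotleft>4\<guillemotright>" by (simp add: tt ee)
    also have "(t \<otimes> t) \<otimes> (e \<otimes> e) = (t \<otimes> e) \<otimes> (t \<otimes> e)"
      unfolding of_int_numerals using R by algebra
    finally show ?thesis using FVe_square by (simp add: t eq_diff0)
  qed
  obtain w where w: "w = \<guillemotleft>2\<guillemotright> \<otimes> y \<oplus> t \<otimes> y \<otimes> y" "w \<in> carrier R" using R by simp
  have d2: "\<guillemotleft>2\<guillemotright> \<otimes> d = \<V> w"
  proof -
    have "\<guillemotleft>2\<guillemotright> \<otimes> d = (\<guillemotleft>2\<guillemotright> \<otimes> d \<ominus> (\<ominus> \<one>)) \<ominus> \<one>"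
      unfolding of_int_numerals using R by algebra
    also have "\<dots> = (\<one> \<oplus> v) \<otimes> (\<one> \<oplus> v) \<ominus> \<one>" using ee e_eq by simp
    also have "\<dots> = \<guillemotleft>2\<guillemotright> \<otimes> v \<oplus> v \<otimes> v"
      unfolding of_int_numerals using R by algebra
    also have "\<dots> = \<V> w" using R by (simp add: v w versch_add versch_double versch_mult t)
    finally show ?thesis .
  qed
  \<comment> \<open>The term \<open>2 \<two> \<otimes> y\<^sup>2\<close> of \<open>2 w\<close> is \<open>8 d \<otimes> y\<close>, because \<open>\<two> \<otimes> y = 4 d\<close>.\<close>
  have "\<guillemotleft>2\<guillemotright> \<otimes> w = \<guillemotleft>4\<guillemotright> \<otimes> y \<oplus> \<guillemotleft>8\<guillemotright> \<otimes> d \<otimes> y"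
  proof -
    have "\<guillemotleft>2\<guillemotright> \<otimes> (\<guillemotleft>2\<guillemotright> \<otimes> y \<oplus> t \<otimes> (t \<otimes> d) \<otimes> y) = \<guillemotleft>4\<guillemotright> \<otimes> y \<oplus> \<guillemotleft>2\<guillemotright> \<otimes> (t \<otimes> t) \<otimes> d \<otimes> y"
      unfolding of_int_numerals using R by algebra
    also have "\<guillemotleft>2\<guillemotright> \<otimes> (t \<otimes> t) \<otimes> d \<otimes> y = \<guillemotleft>8\<guillemotright> \<otimes> d \<otimes> y" unfolding tt
      unfolding of_int_numerals using R by algebra
    finally show ?thesis using R d8 by (simp add: w y m_assoc)
  qed
  then have w2: "\<guillemotleft>2\<guillemotright> \<otimes> w = \<guillemotleft>4\<guillemotright> \<otimes> y" using R d8 by simp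
  have y2: "\<guillemotleft>2\<guillemotright> \<otimes> y = \<V> (\<guillemotleft>4\<guillemotright> \<otimes> y)"
  proof -
    have "\<guillemotleft>2\<guillemotright> \<otimes> y = t \<otimes> (\<guillemotleft>2\<guillemotright> \<otimes> d)"
      unfolding y(1) unfolding of_int_numerals using R by algebra
    also have "\<dots> = \<V> (\<guillemotleft>2\<guillemotright> \<otimes> w)" using w(2) by (simp add: d2 t(1) two_tilde_versch)
    finally show ?thesis by (simp only: w2)
  qed
  have y4: "\<guillemotleft>4\<guillemotright> \<otimes> y = \<zero>"
  proof -
    have "\<guillemotleft>4\<guillemotright> \<otimes> y = \<guillemotleft>2\<guillemotright> \<otimes> (\<guillemotleft>2\<guillemotright> \<otimes> y)"
      unfolding of_int_numerals using R by algebra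
    also have "\<dots> = \<V> (\<guillemotleft>2\<guillemotright> \<otimes> (\<guillemotleft>4\<guillemotright> \<otimes> y))" using R by (simp only: y2 versch_double m_closed of_int_closed)
    also have "\<guillemotleft>2\<guillemotright> \<otimes> (\<guillemotleft>4\<guillemotright> \<otimes> (t \<otimes> d)) = \<guillemotleft>8\<guillemotright> \<otimes> d \<otimes> t"
      unfolding of_int_numerals using R by algebra
    then have "\<guillemotleft>2\<guillemotright> \<otimes> (\<guillemotleft>4\<guillemotright> \<otimes> y) = \<zero>" using R by (simp add: y d8)
    finally show ?thesis by simp
  qed
  then have y2: "\<guillemotleft>2\<guillemotright> \<otimes> y = \<zero>" using y2 by simp
  have "w = \<zero>"
  proof -
    have "t \<otimes> y \<otimes> (t \<otimes> d) = (t \<otimes> t) \<otimes> y \<otimes> d"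
      unfolding of_int_numerals using R by algebra
    then show ?thesis using R by (simp add: w y2 tt y4 flip: y(1))
  qed
  then have d2: "\<guillemotleft>2\<guillemotright> \<otimes> d = \<zero>" using d2 by simp
  have "\<guillemotleft>2\<guillemotright> \<otimes> z \<ominus> d \<otimes> d = \<zero>"
    using delta_double[OF d(2)] by (simp add: d2 z delta_zero)
  then have "\<delta> y = \<zero>" using delta_two_tilde_mult[OF d(2)] by (simp add: t z y(1))
  then have "\<delta> v = \<ominus> y" using delta_versch[OF y(2)] R by (simp add: v)
  then have d_eq: "d = \<ominus> y \<ominus> v"
    using delta_add[of \<one> v] R by (simp add: d(1) e_eq delta_one delta_closed)
  have "y = \<zero>"
  proof -
    have "t \<otimes> (\<ominus> (t \<otimes> d) \<ominus> v) = \<ominus> (t \<otimes> t \<otimes> d) \<ominus> t \<otimes> v"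
      unfolding of_int_numerals using R by algebra
    moreover have "t \<otimes> t \<otimes> d = \<zero>"
    proof -
      have "\<guillemotleft>4\<guillemotright> \<otimes> d = \<guillemotleft>2\<guillemotright> \<otimes> (\<guillemotleft>2\<guillemotright> \<otimes> d)"
        unfolding of_int_numerals using R by algebra
      then show ?thesis by (simp add: tt d2)
    qed
    moreover have "t \<otimes> v = \<zero>" using R y2 by (simp add: t v two_tilde_versch)
    ultimately have "t \<otimes> (\<ominus> y \<ominus> v) = \<zero>" by (simp add: y(1) minus_eq)
    then show ?thesis using arg_cong[OF d_eq, of "\<lambda>x. t \<otimes> x"] by (simp flip: y(1))
  qed
  then show ?thesis using e_eq v by simp
qed

text \<open>The hypotheses say that \<open>\<V> c\<close> and \<open>\<V> u\<close> have the same image under \<open>\<F>\<close> and under \<open>\<delta>\<close>.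
  The difference \<open>h = c \<ominus> u\<close> is \<open>\<V> k\<close> with \<open>k = \<two> \<otimes> \<delta> c \<ominus> \<two> \<otimes> \<delta> u\<close>, and \<open>\<two> \<otimes> h = \<zero>\<close>.
  Injectivity of \<open>\<V>\<close> gives \<open>2 k = \<zero>\<close>, so \<open>h\<close> is killed by \<open>2\<close> and therefore by \<open>\<F>\<close>, which means
  \<open>\<two> \<otimes> k = \<zero>\<close>. Expanding \<open>\<delta> (u \<oplus> h)\<close> shows \<open>k = \<two> \<otimes> \<delta> h\<close>, and expanding \<open>\<delta> h = \<delta> (\<V> k)\<close>
  shows that this vanishes.\<close>

lemma eq_if_frobenius_delta_versch:
  assumes c: "c \<in> carrier R" and u: "u \<in> carrier R"
    and two_c: "\<two> \<otimes> c = \<two> \<otimes> u"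
    and delta_Vc: "\<delta> (\<V> c) = \<ominus> u \<oplus> \<V> (\<two> \<otimes> \<delta> u)"
  shows "c = u"
proof -
  obtain t where t: "t = \<two>" "t \<in> carrier R" by simp
  obtain x where x: "x = \<delta> c" "x \<in> carrier R" using c delta_closed by blast
  obtain y where y: "y = \<delta> u" "y \<in> carrier R" using u delta_closed by blast
  obtain h where h: "h = c \<ominus> u" "h \<in> carrier R" using c u by simp
  obtain k where k: "k = t \<otimes> x \<ominus> t \<otimes> y" "k \<in> carrier R" using t x y by simp
  obtain z where z: "z = \<delta> h" "z \<in> carrier R" using h delta_closed by blast
  obtain m where m: "m = \<delta> k" "m \<in> carrier R" using k delta_closed by blast
  obtain p where p: "p = \<V> (t \<otimes> x)" "p \<in> carrier R" using t x versch_closed by simp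
  obtain q where q: "q = \<V> (t \<otimes> y)" "q \<in> carrier R" using t y versch_closed by simp
  note R = c u t(2) x(2) y(2) h(2) k(2) z(2) m(2) p(2) q(2)
  have "(\<ominus> c \<oplus> p) \<ominus> (\<ominus> u \<oplus> q) = \<zero>"
    using delta_versch[OF c] delta_Vc R by (simp add: eq_diff0 flip: t(1) x(1) y(1) p(1) q(1))
  moreover have "c \<ominus> u = (p \<ominus> q) \<ominus> ((\<ominus> c \<oplus> p) \<ominus> (\<ominus> u \<oplus> q))"
    unfolding of_int_numerals using R by algebra
  ultimately have hV: "h = \<V> k"
    using R by (simp add: h(1) k(1) p q versch_diff eq_diff0)
  have th: "t \<otimes> h = \<zero>"
  proof -
    have "t \<otimes> (c \<ominus> u) = t \<otimes> c \<ominus> t \<otimes> u"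
      unfolding of_int_numerals using R by algebra
    then show ?thesis using two_c R by (simp add: h(1) t eq_diff0)
  qed
  have k2: "\<guillemotleft>2\<guillemotright> \<otimes> k = \<zero>"
  proof (rule versch_eq_zeroD)
    show "\<V> (\<guillemotleft>2\<guillemotright> \<otimes> k) = \<zero>" using two_tilde_versch[OF k(2)] th by (simp add: hV t)
  qed (use R in simp)
  have "\<guillemotleft>2\<guillemotright> \<otimes> h = \<zero>" using versch_double[OF k(2)] by (simp add: hV k2)
  then have tk: "t \<otimes> k = \<zero>"
    using frobenius_two_torsion[OF h(2)] frobenius_versch[OF k(2)] by (simp add: hV t)
  have kk: "\<guillemotleft>2\<guillemotright> \<otimes> m = k \<otimes> k"
    using delta_double[OF k(2), symmetric] R by (simp add: k2 m delta_zero eq_diff0)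
  have k_eq: "k = t \<otimes> z"
  proof -
    have "x = (y \<oplus> z) \<ominus> u \<otimes> h"
    proof -
      have "c = u \<oplus> h" unfolding h(1) unfolding of_int_numerals using R by algebra
      then show ?thesis using delta_add[OF u h(2)] by (simp add: x y z)
    qed
    moreover have "t \<otimes> ((y \<oplus> z) \<ominus> u \<otimes> h) \<ominus> t \<otimes> y = t \<otimes> z \<ominus> u \<otimes> (t \<otimes> h)"
      unfolding of_int_numerals using R by algebra
    ultimately show ?thesis using R by (simp add: k(1) th)
  qed
  have "z = \<ominus> k \<oplus> \<V> (t \<otimes> m)" using delta_versch[OF k(2)] by (simp add: z hV t m)
  then have "t \<otimes> z = \<ominus> (t \<otimes> k) \<oplus> t \<otimes> \<V> (t \<otimes> m)"
    using R by (simp add: r_distr r_minus versch_closed)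
  also have "\<dots> = \<V> (\<guillemotleft>2\<guillemotright> \<otimes> (t \<otimes> m))" using R by (simp add: tk two_tilde_versch[folded t(1)] versch_closed)
  also have "\<guillemotleft>2\<guillemotright> \<otimes> (t \<otimes> m) = t \<otimes> (\<guillemotleft>2\<guillemotright> \<otimes> m)"
    unfolding of_int_numerals using R by algebra
  also have "\<dots> = t \<otimes> k \<otimes> k" using R by (simp add: kk m_assoc)
  finally have "t \<otimes> z = \<zero>" using R by (simp add: tk)
  then have "k = \<zero>" using k_eq by simp
  then show ?thesis using hV h c u by (simp add: eq_diff0)
qed

end

section \<open>Maps of delta-rings preserving the Verschiebung ideal\<close>

lemma delta_ring_hom_frobenius:
  assumes "delta_ring A" "delta_ring B" and f: "f \<in> delta_ring_hom A B" and a: "a \<in> carrier A"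
  shows "f (\<F>\<^bsub>A\<^esub> a) = \<F>\<^bsub>B\<^esub> (f a)"
proof -
  interpret A: delta_ring A by fact
  interpret B: delta_ring B by fact
  interpret ring_hom_cring A B f
    using f by unfold_locales (simp add: delta_ring_hom_def)
  show ?thesis
    using f a
    by (simp add: frobenius_def numeral_2_eq_2 delta_ring_hom_def A.delta_closed B.delta_closed)
qed

text \<open>The argument for \<open>\<V> \<one>\<close> comes first, because the general one compares \<open>\<F> (f (\<V> a)) = f \<two> \<otimes> f a\<close>
  with \<open>\<two> \<otimes> f a\<close> and needs \<open>f \<two> = \<two>\<close>.\<close>

theorem delta_ring_hom_preserving_versch_ideal:
  assumes "delta_cartier_ring A" "delta_cartier_ring B"
    and f: "f \<in> delta_ring_hom A B" and fV: "f ` versch_ideal A \<subseteq> versch_ideal B"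
  shows "f \<in> delta_cartier_ring_hom A B"
proof -
  interpret A: delta_cartier_ring A by fact
  interpret B: delta_cartier_ring B by fact
  interpret ring_hom_cring A B f
    using f by unfold_locales (simp add: delta_ring_hom_def)
  have f_delta: "f (\<delta>\<^bsub>A\<^esub> a) = \<delta>\<^bsub>B\<^esub> (f a)" if "a \<in> carrier A" for a
    using f that by (simp add: delta_ring_hom_def)
  have f_frob: "f (\<F>\<^bsub>A\<^esub> a) = \<F>\<^bsub>B\<^esub> (f a)" if "a \<in> carrier A" for a
    using delta_ring_hom_frobenius[OF _ _ f that] A.delta_ring_axioms B.delta_ring_axioms by blast
  have f_versch: "\<exists>c \<in> carrier B. f (\<V>\<^bsub>A\<^esub> a) = \<V>\<^bsub>B\<^esub> c" if "a \<in> carrier A" for a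
    using fV that by (fastforce simp: versch_ideal_def)
  have f_one: "f (\<V>\<^bsub>A\<^esub> \<one>\<^bsub>A\<^esub>) = \<V>\<^bsub>B\<^esub> \<one>\<^bsub>B\<^esub>"
  proof -
    obtain e where e: "e \<in> carrier B" "f (\<V>\<^bsub>A\<^esub> \<one>\<^bsub>A\<^esub>) = \<V>\<^bsub>B\<^esub> e"
      using f_versch[of "\<one>\<^bsub>A\<^esub>"] by auto
    have ft: "f \<two>\<^bsub>A\<^esub> = \<two>\<^bsub>B\<^esub> \<otimes>\<^bsub>B\<^esub> e"
      using f_frob[of "\<V>\<^bsub>A\<^esub> \<one>\<^bsub>A\<^esub>"] e
      by (simp add: A.versch_closed B.frobenius_versch flip: two_tilde_def)
    have "e = \<one>\<^bsub>B\<^esub>"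
    proof (rule B.eq_one_if_versch_like_versch_one)
      show "e \<in> carrier B" by fact
      show "\<delta>\<^bsub>B\<^esub> (\<V>\<^bsub>B\<^esub> e) = \<ominus>\<^bsub>B\<^esub> \<one>\<^bsub>B\<^esub>"
        using f_delta[of "\<V>\<^bsub>A\<^esub> \<one>\<^bsub>A\<^esub>"] e
        by (simp add: A.versch_closed A.delta_versch A.delta_one)
      show "\<delta>\<^bsub>B\<^esub> (\<two>\<^bsub>B\<^esub> \<otimes>\<^bsub>B\<^esub> e) = \<ominus>\<^bsub>B\<^esub> \<one>\<^bsub>B\<^esub>"
        using f_delta[of "\<two>\<^bsub>A\<^esub>"] by (simp add: A.delta_two_tilde ft)
      have "f (\<two>\<^bsub>A\<^esub> [^]\<^bsub>A\<^esub> (2::nat)) = f \<two>\<^bsub>A\<^esub> [^]\<^bsub>B\<^esub> (2::nat)"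
        by (simp add: numeral_2_eq_2)
      moreover have "f ([(4::nat)] \<cdot>\<^bsub>A\<^esub> \<one>\<^bsub>A\<^esub>) = [(4::nat)] \<cdot>\<^bsub>B\<^esub> \<one>\<^bsub>B\<^esub>"
        by (simp add: eval_nat_numeral)
      ultimately show "(\<two>\<^bsub>B\<^esub> \<otimes>\<^bsub>B\<^esub> e) \<otimes>\<^bsub>B\<^esub> (\<two>\<^bsub>B\<^esub> \<otimes>\<^bsub>B\<^esub> e) = \<guillemotleft>4\<guillemotright>\<^bsub>B\<^esub>"
        using e by (simp add: A.two_tilde_square ft B.power2_eq_square B.add_pow_four_one)
    qed
    then show ?thesis using e by simp
  qed
  have ft: "f \<two>\<^bsub>A\<^esub> = \<two>\<^bsub>B\<^esub>"
    using f_frob[of "\<V>\<^bsub>A\<^esub> \<one>\<^bsub>A\<^esub>"] f_one by (simp add: A.versch_closed two_tilde_def)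
  \<comment> \<open>Comparing Frobenius images settles the claim after multiplication by \<open>\<two>\<close>.\<close>
  have two_mult: "\<two>\<^bsub>B\<^esub> \<otimes>\<^bsub>B\<^esub> c = \<two>\<^bsub>B\<^esub> \<otimes>\<^bsub>B\<^esub> f a"
    if "a \<in> carrier A" "c \<in> carrier B" "f (\<V>\<^bsub>A\<^esub> a) = \<V>\<^bsub>B\<^esub> c" for a c
    using f_frob[of "\<V>\<^bsub>A\<^esub> a"] that
    by (simp add: A.versch_closed A.frobenius_versch B.frobenius_versch ft)
  have "f (\<V>\<^bsub>A\<^esub> a) = \<V>\<^bsub>B\<^esub> (f a)" if a: "a \<in> carrier A" for a
  proof -
    obtain c where c: "c \<in> carrier B" "f (\<V>\<^bsub>A\<^esub> a) = \<V>\<^bsub>B\<^esub> c" using f_versch a by blast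
    \<comment> \<open>The factor \<open>\<two>\<close> makes up for knowing \<open>f (\<V> b) = \<V> c\<close> only up to \<open>\<two> \<otimes> c = \<two> \<otimes> f b\<close>.\<close>
    have f_versch_two: "f (\<V>\<^bsub>A\<^esub> (\<two>\<^bsub>A\<^esub> \<otimes>\<^bsub>A\<^esub> b)) = \<V>\<^bsub>B\<^esub> (\<two>\<^bsub>B\<^esub> \<otimes>\<^bsub>B\<^esub> f b)"
      if b: "b \<in> carrier A" for b
    proof -
      obtain c where c: "c \<in> carrier B" "f (\<V>\<^bsub>A\<^esub> b) = \<V>\<^bsub>B\<^esub> c" using f_versch b by blast
      have "f (\<V>\<^bsub>A\<^esub> (\<two>\<^bsub>A\<^esub> \<otimes>\<^bsub>A\<^esub> b)) = f (\<V>\<^bsub>A\<^esub> \<one>\<^bsub>A\<^esub> \<otimes>\<^bsub>A\<^esub> \<V>\<^bsub>A\<^esub> b)"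
        using b by (simp add: A.versch_mult)
      also have "\<dots> = \<V>\<^bsub>B\<^esub> \<one>\<^bsub>B\<^esub> \<otimes>\<^bsub>B\<^esub> \<V>\<^bsub>B\<^esub> c"
        using b c by (simp add: A.versch_closed f_one)
      also have "\<dots> = \<V>\<^bsub>B\<^esub> (\<two>\<^bsub>B\<^esub> \<otimes>\<^bsub>B\<^esub> f b)"
        using two_mult[OF b c] c by (simp add: B.versch_mult)
      finally show ?thesis .
    qed
    have "\<delta>\<^bsub>B\<^esub> (\<V>\<^bsub>B\<^esub> c) = f (\<delta>\<^bsub>A\<^esub> (\<V>\<^bsub>A\<^esub> a))"
      using a c by (simp add: f_delta A.versch_closed)
    also have "\<dots> = \<ominus>\<^bsub>B\<^esub> f a \<oplus>\<^bsub>B\<^esub> \<V>\<^bsub>B\<^esub> (\<two>\<^bsub>B\<^esub> \<otimes>\<^bsub>B\<^esub> \<delta>\<^bsub>B\<^esub> (f a))"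
      using a by (simp add: A.delta_versch A.versch_closed A.delta_closed f_versch_two f_delta)
    finally have "c = f a"
      using B.eq_if_frobenius_delta_versch[of c "f a"] two_mult[OF a c] a c by simp
    then show ?thesis using c by simp
  qed
  then show ?thesis using f by (simp add: delta_cartier_ring_hom_def)
qed

section \<open>The functor to delta-pairs\<close>

lemma delta_ring_hom_id: "(\<lambda>a \<in> carrier A. a) \<in> delta_ring_hom A A" if "delta_ring A"
proof -
  interpret delta_ring A by fact
  show ?thesis by (auto simp: delta_ring_hom_def ring_hom_def delta_closed)
qed

lemma delta_ring_hom_compose:
  assumes "delta_ring A" "f \<in> delta_ring_hom A B" "g \<in> delta_ring_hom B C"
  shows "compose (carrier A) g f \<in> delta_ring_hom A C"
proof -
  interpret delta_ring A by fact
  have f: "f \<in> ring_hom A B" and g: "g \<in> ring_hom B C"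
    using assms(2,3) by (simp_all add: delta_ring_hom_def)
  note hom = ring_hom_closed[OF f] ring_hom_closed[OF g] ring_hom_mult[OF f] ring_hom_mult[OF g]
    ring_hom_add[OF f] ring_hom_add[OF g] ring_hom_one[OF f] ring_hom_one[OF g]
  have "compose (carrier A) g f \<in> ring_hom A C"
    by (rule ring_hom_memI) (simp_all add: compose_eq hom)
  then show ?thesis
    using assms(2,3) by (simp add: delta_ring_hom_def compose_eq delta_closed hom)
qed

lemma delta_ring_homD: "f \<in> delta_ring_hom A B \<Longrightarrow> f \<in> carrier A \<rightarrow> carrier B"
  by (simp add: delta_ring_hom_def ring_hom_def)

lemma category_delta_cartier_ring: "category delta_cartier_ring_cat"
proof
  fix W X Y Z :: "'a delta_cartier_ring" and f g h :: "'a \<Rightarrow> 'a"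
  let ?C = "delta_cartier_ring_cat"
  note defs = delta_cartier_ring_cat_def delta_cartier_ring_hom_def
  have dr: "delta_ring A" if "delta_cartier_ring A" for A :: "'a delta_cartier_ring"
    using that delta_cartier_ring.axioms(1) by blast
  show "cat_id ?C X \<in> cat_hom ?C X X" if "X \<in> cat_obj ?C"
    using that by (auto simp: defs delta_ring_hom_id dr delta_cartier_ring.versch_closed)
  show "cat_comp ?C X Y Z g f \<in> cat_hom ?C X Z"
    if "X \<in> cat_obj ?C" "f \<in> cat_hom ?C X Y" "g \<in> cat_hom ?C Y Z"
    using that delta_ring_homD[of f X Y]
    by (auto simp: defs dr delta_cartier_ring.versch_closed compose_eq Pi_iff
        intro: delta_ring_hom_compose)
  show "cat_comp ?C X Y Y (cat_id ?C Y) f = f" if "f \<in> cat_hom ?C X Y"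
    using that delta_ring_homD[of f X Y] by (auto simp: defs intro!: Id_compose)
  show "cat_comp ?C X X Y f (cat_id ?C X) = f" if "f \<in> cat_hom ?C X Y"
    using that delta_ring_homD[of f X Y] by (auto simp: defs intro!: compose_Id)
  show "cat_comp ?C W Y Z h (cat_comp ?C W X Y g f) = cat_comp ?C W X Z (cat_comp ?C X Y Z h g) f"
    if "f \<in> cat_hom ?C W X"
    using that delta_ring_homD[of f W X] compose_assoc[of f "carrier W" "carrier X" h g]
    by (auto simp: defs)
qed

lemma category_delta_pair: "category delta_pair_cat"
proof
  fix W X Y Z :: "'a delta_ring \<times> 'a set" and f g h :: "'a \<Rightarrow> 'a"
  let ?C = "delta_pair_cat"
  note defs = delta_pair_cat_def split_beta
  have sub: "a \<in> carrier A" if "ideal I A" "a \<in> I" for a I and A :: "'a delta_ring"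
    using that by (rule additive_subgroup.a_Hcarr[OF ideal.axioms(1)])
  show "cat_id ?C X \<in> cat_hom ?C X X" if "X \<in> cat_obj ?C"
    using that by (auto simp: defs delta_ring_hom_id sub)
  show "cat_comp ?C X Y Z g f \<in> cat_hom ?C X Z"
    if "X \<in> cat_obj ?C" "f \<in> cat_hom ?C X Y" "g \<in> cat_hom ?C Y Z"
    using that by (auto simp: defs compose_eq sub image_subset_iff intro: delta_ring_hom_compose)
  show "cat_comp ?C X Y Y (cat_id ?C Y) f = f" if "f \<in> cat_hom ?C X Y"
    using that delta_ring_homD[of f "fst X" "fst Y"] by (auto simp: defs intro!: Id_compose)
  show "cat_comp ?C X X Y f (cat_id ?C X) = f" if "f \<in> cat_hom ?C X Y"
    using that delta_ring_homD[of f "fst X" "fst Y"] by (auto simp: defs intro!: compose_Id)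
  show "cat_comp ?C W Y Z h (cat_comp ?C W X Y g f) = cat_comp ?C W X Z (cat_comp ?C X Y Z h g) f"
    if "f \<in> cat_hom ?C W X"
    using that delta_ring_homD[of f "fst W" "fst X"]
      compose_assoc[of f "carrier (fst W)" "carrier (fst X)" h g]
    by (auto simp: defs)
qed

text \<open>Unfolding \<open>truncate\<close> itself would expose a record literal under \<open>\<ominus>\<close>, to which
  \<open>a_inv_truncate\<close> below does not apply; hence the field-wise equations.\<close>

lemma truncate_simps:
  "carrier (delta_ring.truncate A) = carrier A"
  "monoid.mult (delta_ring.truncate A) = monoid.mult A"
  "monoid.one (delta_ring.truncate A) = monoid.one A"
  "ring.zero (delta_ring.truncate A) = ring.zero A"
  "ring.add (delta_ring.truncate A) = ring.add A"
  "delta (delta_ring.truncate A) = delta A"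
  by (simp_all add: delta_ring.defs)

context
  fixes A :: "('a, 'm) delta_ring_scheme"
  assumes delta_ring_A: "delta_ring A"
begin

interpretation A: delta_ring A by (rule delta_ring_A)

interpretation truncate: cring "delta_ring.truncate A"
proof (rule cringI)
  show "abelian_group (delta_ring.truncate A)"
    by (rule abelian_groupI)
      (auto simp: truncate_simps A.a_assoc intro: A.a_comm bexI[of _ "\<ominus>\<^bsub>A\<^esub> _"] A.l_neg)
  show "comm_monoid (delta_ring.truncate A)"
    by (rule comm_monoidI) (auto simp: truncate_simps A.m_assoc intro: A.m_comm)
qed (simp add: truncate_simps A.l_distr)

lemma a_inv_truncate:
  "x \<in> carrier A \<Longrightarrow> \<ominus>\<^bsub>delta_ring.truncate A\<^esub> x = \<ominus>\<^bsub>A\<^esub> x"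
  by (rule truncate.minus_equality) (simp_all add: truncate_simps A.l_neg)

lemma delta_ring_truncate: "delta_ring (delta_ring.truncate A)"
proof
  let ?T = "delta_ring.truncate A"
  fix a b
  assume "a \<in> carrier ?T" "b \<in> carrier ?T"
  then have a: "a \<in> carrier A" and b: "b \<in> carrier A" by (simp_all add: truncate_simps)
  show "\<delta>\<^bsub>?T\<^esub> (a \<oplus>\<^bsub>?T\<^esub> b) = (\<delta>\<^bsub>?T\<^esub> a \<oplus>\<^bsub>?T\<^esub> \<delta>\<^bsub>?T\<^esub> b) \<ominus>\<^bsub>?T\<^esub> a \<otimes>\<^bsub>?T\<^esub> b"
    using a b A.delta_add[OF a b] by (simp add: a_minus_def a_inv_truncate truncate_simps)
  show "\<delta>\<^bsub>?T\<^esub> (a \<otimes>\<^bsub>?T\<^esub> b) =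
      a [^]\<^bsub>?T\<^esub> (2::nat) \<otimes>\<^bsub>?T\<^esub> \<delta>\<^bsub>?T\<^esub> b \<oplus>\<^bsub>?T\<^esub> b [^]\<^bsub>?T\<^esub> (2::nat) \<otimes>\<^bsub>?T\<^esub> \<delta>\<^bsub>?T\<^esub> a
        \<oplus>\<^bsub>?T\<^esub> [(2::nat)] \<cdot>\<^bsub>?T\<^esub> (\<delta>\<^bsub>?T\<^esub> a \<otimes>\<^bsub>?T\<^esub> \<delta>\<^bsub>?T\<^esub> b)"
    using a b A.delta_mult[OF a b]
    by (simp add: numeral_2_eq_2 add_pow_def nat_pow_def truncate_simps)
qed (simp_all add: truncate_simps A.delta_closed A.delta_zero A.delta_one)

lemma ideal_truncate:
  assumes "ideal I A"
  shows "ideal I (delta_ring.truncate A)"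
proof (rule idealI)
  interpret ideal I A by fact
  show "ring (delta_ring.truncate A)" ..
  show "subgroup I (add_monoid (delta_ring.truncate A))"
  proof (rule truncate.add.subgroupI)
    show "I \<subseteq> carrier (delta_ring.truncate A)" by (simp add: truncate_simps a_subset)
    show "I \<noteq> {}" using zero_closed by blast
    show "\<ominus>\<^bsub>delta_ring.truncate A\<^esub> x \<in> I" if "x \<in> I" for x
      using that by (simp add: a_inv_truncate a_Hcarr)
    show "x \<oplus>\<^bsub>delta_ring.truncate A\<^esub> y \<in> I" if "x \<in> I" "y \<in> I" for x y
      using that by (simp add: truncate_simps)
  qed
qed (use assms in \<open>simp_all add: truncate_simps ideal.I_l_closed ideal.I_r_closed\<close>)

end

lemma delta_ring_hom_truncate:
  "delta_ring_hom (delta_ring.truncate A) (delta_ring.truncate B) = delta_ring_hom A B"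
  by (simp add: delta_ring_hom_def ring_hom_def truncate_simps)

lemma delta_cartier_ring_hom_iff:
  assumes "delta_cartier_ring A" "delta_cartier_ring B"
  shows "f \<in> delta_cartier_ring_hom A B \<longleftrightarrow>
    f \<in> delta_ring_hom A B \<and> f ` versch_ideal A \<subseteq> versch_ideal B"
proof -
  have "f ` versch_ideal A \<subseteq> versch_ideal B" if "f \<in> delta_cartier_ring_hom A B"
    using that by (auto simp: delta_cartier_ring_hom_def versch_ideal_def
        dest!: delta_ring_homD)
  moreover have "delta_cartier_ring_hom A B \<subseteq> delta_ring_hom A B"
    by (auto simp: delta_cartier_ring_hom_def)
  ultimately show ?thesis
    using delta_ring_hom_preserving_versch_ideal[OF assms] by blast
qed

lemma delta_pair_hom_eq:
  assumes "delta_cartier_ring A" "delta_cartier_ring B"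
  shows "cat_hom delta_pair_cat (underlying_pair A) (underlying_pair B) =
    cat_hom delta_cartier_ring_cat A B"
  using delta_cartier_ring_hom_iff[OF assms]
  by (auto simp: delta_pair_cat_def underlying_pair_def delta_cartier_ring_cat_def
      delta_ring_hom_truncate truncate_simps)

theorem theorem5p50:
  shows "(\<forall>(A :: 'a delta_cartier_ring) (B :: 'b delta_cartier_ring) f.
           delta_cartier_ring A \<longrightarrow> delta_cartier_ring B \<longrightarrow>
           f \<in> delta_ring_hom A B \<longrightarrow> f ` versch_ideal A \<subseteq> versch_ideal B \<longrightarrow>
           f \<in> delta_cartier_ring_hom A B)
       \<and> fully_faithful_functor
           (delta_cartier_ring_cat :: ('c delta_cartier_ring, 'c \<Rightarrow> 'c) cat)
           (delta_pair_cat :: ('c delta_ring \<times> 'c set, 'c \<Rightarrow> 'c) cat)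
           underlying_pair (\<lambda>A B f. f)"
proof (intro conjI allI impI)
  fix A :: "'a delta_cartier_ring" and B :: "'b delta_cartier_ring" and f
  assume "delta_cartier_ring A" "delta_cartier_ring B" "f \<in> delta_ring_hom A B"
    "f ` versch_ideal A \<subseteq> versch_ideal B"
  then show "f \<in> delta_cartier_ring_hom A B"
    by (rule delta_ring_hom_preserving_versch_ideal)
next
  let ?C = "delta_cartier_ring_cat :: ('c delta_cartier_ring, 'c \<Rightarrow> 'c) cat"
  let ?D = "delta_pair_cat :: ('c delta_ring \<times> 'c set, 'c \<Rightarrow> 'c) cat"
  interpret C: category ?C by (rule category_delta_cartier_ring)
  interpret D: category ?D by (rule category_delta_pair)
  have obj: "delta_cartier_ring X" if "X \<in> cat_obj ?C" for X
    using that by (simp add: delta_cartier_ring_cat_def)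
  show "fully_faithful_functor ?C ?D underlying_pair (\<lambda>A B f. f)"
  proof
    fix X Y Z f g
    show "underlying_pair X \<in> cat_obj ?D" if "X \<in> cat_obj ?C"
    proof -
      interpret delta_cartier_ring X using obj[OF that] .
      show ?thesis
        by (simp add: delta_pair_cat_def underlying_pair_def delta_ring_truncate ideal_truncate
            delta_ring_axioms versch_ideal_is_ideal)
    qed
    show "cat_id ?C X = cat_id ?D (underlying_pair X)"
      by (simp add: delta_cartier_ring_cat_def delta_pair_cat_def underlying_pair_def
          truncate_simps)
    show "cat_comp ?C X Y Z g f =
        cat_comp ?D (underlying_pair X) (underlying_pair Y) (underlying_pair Z) g f"
      by (simp add: delta_cartier_ring_cat_def delta_pair_cat_def underlying_pair_def
          truncate_simps)
    assume "X \<in> cat_obj ?C" "Y \<in> cat_obj ?C"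
    then have eq: "cat_hom ?D (underlying_pair X) (underlying_pair Y) = cat_hom ?C X Y"
      using obj delta_pair_hom_eq by blast
    then show "f \<in> cat_hom ?D (underlying_pair X) (underlying_pair Y)" if "f \<in> cat_hom ?C X Y"
      using that by simp
    show "bij_betw (\<lambda>f. f) (cat_hom ?C X Y) (cat_hom ?D (underlying_pair X) (underlying_pair Y))"
      by (simp add: eq flip: id_def)
  qed
qed

end
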